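(* Let $(E,\omega)$ be a 2-dimensional symplectic vector space over $\mathbb{C}$ with basis $x,y$ such that $\omega(x,y)=1$, and let $TE=\bigoplus_{i\ge 0}E^{\otimes i}$ be its tensor algebra. Let $\{\,,\,\}_\omega:TE\times TE\to TE$ be the bilinear pairing given, for $p,q\ge 0$ and $u_1,\dots,u_p,v_1,\dots,v_q\in E$, by $$\{u_1\otimes\cdots\otimes u_p,\;v_1\otimes\cdots\otimes v_q\}_\omega=\sum_{i=1}^p\sum_{j=1}^q\omega(u_i,v_j)\; u_{i+1}\otimes\cdots\otimes u_p\otimes u_1\otimes\cdots\otimes u_{i-1}\otimes v_{j+1}\otimes\cdots\otimes v_q\otimes v_1\otimes\cdots\otimes v_{j-1}.$$ Then $\{\,,\,\}_\omega$ gives rise to a well-defined Lie algebra structure on the vector space $TE/[TE,TE]$.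
   Context: $[TE,TE]\subset TE$ denotes the $\mathbb{C}$-linear span of the set $\{a\cdot b-b\cdot a\}_{a,b\in TE}$. An empty sum (the case $p=0$ or $q=0$) is zero. *)

theory Defs
  imports "HOL-Analysis.Analysis" "HOL-Library.Poly_Mapping"
begin

section \<open>Complex vector spaces\<close>

class complex_vector = ab_group_add +
  fixes scaleC :: "complex \<Rightarrow> 'a \<Rightarrow> 'a"  (infixr \<open>*\<^sub>C\<close> 75)
  assumes scaleC_add_right: "c *\<^sub>C (a + b) = c *\<^sub>C a + c *\<^sub>C b"
    and scaleC_add_left: "(c + d) *\<^sub>C a = c *\<^sub>C a + d *\<^sub>C a"
    and scaleC_scaleC: "c *\<^sub>C d *\<^sub>C a = (c * d) *\<^sub>C a"
    and scaleC_one: "1 *\<^sub>C a = a"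

global_interpretation cvec: vector_space "scaleC :: complex \<Rightarrow> 'a \<Rightarrow> 'a::complex_vector"
  by unfold_locales (simp_all add: scaleC_add_right scaleC_add_left scaleC_scaleC scaleC_one)

instantiation complex :: complex_vector
begin

definition scaleC_complex :: "complex \<Rightarrow> complex \<Rightarrow> complex"
  where "scaleC_complex c a = c * a"

instance
  by standard (simp_all add: scaleC_complex_def algebra_simps)

end

instantiation poly_mapping :: (type, complex_vector) complex_vector
begin

lift_definition scaleC_poly_mapping :: "complex \<Rightarrow> ('a \<Rightarrow>\<^sub>0 'b) \<Rightarrow> 'a \<Rightarrow>\<^sub>0 'b"
  is "\<lambda>c f k. c *\<^sub>C f k"
  by (rule finite_subset) auto

instance
  by standard (transfer, simp add: fun_eq_iff cvec.scale_right_distrib cvec.scale_left_distrib)+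

end

definition clinear :: "('a::complex_vector \<Rightarrow> 'b::complex_vector) \<Rightarrow> bool"
  where "clinear = Vector_Spaces.linear scaleC scaleC"

definition cbilinear ::
  "('a::complex_vector \<Rightarrow> 'b::complex_vector \<Rightarrow> 'c::complex_vector) \<Rightarrow> bool"
  where "cbilinear B \<longleftrightarrow> (\<forall>a. clinear (B a)) \<and> (\<forall>b. clinear (\<lambda>a. B a b))"

lemma clinear_iff:
  "clinear f \<longleftrightarrow> (\<forall>a b. f (a + b) = f a + f b) \<and> (\<forall>c a. f (c *\<^sub>C a) = c *\<^sub>C f a)"
  unfolding clinear_def Vector_Spaces.linear_iff by (blast intro: cvec.vector_space_axioms)

lemma clinear_zero: "clinear f \<Longrightarrow> f 0 = 0"
  by (metis add_cancel_right_right clinear_iff)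

definition symplectic_form :: "('e::complex_vector \<Rightarrow> 'e \<Rightarrow> complex) \<Rightarrow> bool"
  where "symplectic_form \<omega> \<longleftrightarrow>
    cbilinear \<omega> \<and> (\<forall>u. \<omega> u u = 0) \<and> (\<forall>u. (\<forall>v. \<omega> u v = 0) \<longrightarrow> u = 0)"

definition lie_bracket :: "('g::complex_vector \<Rightarrow> 'g \<Rightarrow> 'g) \<Rightarrow> bool"
  where "lie_bracket br \<longleftrightarrow>
    cbilinear br \<and> (\<forall>a. br a a = 0) \<and>
    (\<forall>a b c. br a (br b c) + br b (br c a) + br c (br a b) = 0)"


section \<open>The tensor algebra\<close>

datatype 'e word = Word (letters: "'e list")

instantiation word :: (type) monoid_add
begin

definition zero_word :: "'a word"
  where "zero_word = Word []"

definition plus_word :: "'a word \<Rightarrow> 'a word \<Rightarrow> 'a word"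
  where "plus_word v w = Word (letters v @ letters w)"

instance
  by standard (simp_all add: zero_word_def plus_word_def)

end

text \<open>
  The free complex vector space on the lists over the set underlying \<open>E\<close> is a unital algebra under
  concatenation. Dividing it by the multilinearity relations below, each of which involves lists of
  one length only, gives in length \<open>i\<close> the tensor power \<open>E\<^sup>\<otimes>\<^sup>i\<close> and altogether the direct sum
  of the tensor powers.
\<close>

type_synonym 'e free_words = "'e word \<Rightarrow>\<^sub>0 complex"

abbreviation free_word :: "'e list \<Rightarrow> 'e free_words"
  where "free_word us \<equiv> Poly_Mapping.single (Word us) 1"

definition multilinearity_relators :: "'e::complex_vector free_words set"
  where "multilinearity_relators =
    {free_word (us @ [a + b] @ vs) - free_word (us @ [a] @ vs) - free_word (us @ [b] @ vs)
      | us a b vs. True} \<union>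
    {free_word (us @ [c *\<^sub>C a] @ vs) - c *\<^sub>C free_word (us @ [a] @ vs) | us c a vs. True}"

definition tensor_rel :: "'e::complex_vector free_words \<Rightarrow> 'e free_words \<Rightarrow> bool"
  where "tensor_rel p q \<longleftrightarrow> p - q \<in> cvec.span multilinearity_relators"

lemma equivp_span_diff: "equivp (\<lambda>p q. p - q \<in> cvec.span S)"
proof (rule equivpI)
  show "reflp (\<lambda>p q. p - q \<in> cvec.span S)"
    by (simp add: reflp_def cvec.span_zero)
  show "symp (\<lambda>p q. p - q \<in> cvec.span S)"
    by (metis (mono_tags, lifting) cvec.span_neg minus_diff_eq sympI)
  show "transp (\<lambda>p q. p - q \<in> cvec.span S)"
  proof (rule transpI)
    fix p q r assume "p - q \<in> cvec.span S" "q - r \<in> cvec.span S"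
    from cvec.span_add[OF this] show "p - r \<in> cvec.span S" by simp
  qed
qed

quotient_type (overloaded) 'e tensor_algebra = "'e::complex_vector free_words" / tensor_rel
  unfolding tensor_rel_def by (rule equivp_span_diff)

lemma tensor_rel_add:
  "tensor_rel p p' \<Longrightarrow> tensor_rel q q' \<Longrightarrow> tensor_rel (p + q) (p' + q')"
  unfolding tensor_rel_def by (metis add_diff_add cvec.span_add)

lemma tensor_rel_scale: "tensor_rel p p' \<Longrightarrow> tensor_rel (c *\<^sub>C p) (c *\<^sub>C p')"
  unfolding tensor_rel_def by (metis cvec.scale_right_diff_distrib cvec.span_scale)

lemma tensor_rel_refl: "tensor_rel p p"
  by (simp add: tensor_rel_def cvec.span_zero)

lemma tensor_rel_eqI: "p = q \<Longrightarrow> tensor_rel p q"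
  by (simp add: tensor_rel_refl)

lemma scaleC_single: "c *\<^sub>C Poly_Mapping.single w d = Poly_Mapping.single w (c * d :: complex)"
  by transfer (auto simp: fun_eq_iff scaleC_complex_def when_def)

lemma scaleC_free_words: "c *\<^sub>C (p :: 'e free_words) = Poly_Mapping.single 0 c * p"
  unfolding mult_map_scale_conv_mult[symmetric]
  by transfer (auto simp: fun_eq_iff scaleC_complex_def when_def)

lemma free_words_induct [case_names zero add]:
  assumes "P 0" "\<And>c us p. P p \<Longrightarrow> P (c *\<^sub>C free_word us + p)"
  shows "P (p :: 'e free_words)"
proof (induction p rule: update_induct)
  case const
  then show ?case using assms(1) by simp
next
  case (update p w c)
  have "Poly_Mapping.update w c p = c *\<^sub>C free_word (letters w) + p"
    using update(1)
    by (intro poly_mapping_eqI)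
      (auto simp: lookup_update lookup_add scaleC_single lookup_single in_keys_iff when_def)
  with assms(2)[OF update(3), of c "letters w"] show ?case by simp
qed

lemma free_word_mult: "free_word us * free_word vs = free_word (us @ vs)"
  by (simp add: mult_single plus_word_def)

lemma scaleC_mult_free_words:
  "(c *\<^sub>C p) * q = c *\<^sub>C (p * q)" "p * (c *\<^sub>C q) = c *\<^sub>C (p * q)" for p q :: "'e free_words"
proof -
  show "(c *\<^sub>C p) * q = c *\<^sub>C (p * q)" for p q :: "'e free_words"
    by (simp add: scaleC_free_words mult.assoc)
  have "Poly_Mapping.single 0 c * p = p * Poly_Mapping.single 0 c" for p :: "'e free_words"
    by (induction p rule: free_words_induct)
      (simp_all add: algebra_simps scaleC_single mult_single)
  then show "p * (c *\<^sub>C q) = c *\<^sub>C (p * q)"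
    by (metis mult.assoc scaleC_free_words)
qed

lemma relators_mult_word:
  assumes "r \<in> multilinearity_relators"
  shows "free_word ws * r \<in> multilinearity_relators"
    and "r * free_word ws \<in> multilinearity_relators"
proof -
  from assms consider
    us a b vs where "r = free_word (us @ [a + b] @ vs) - free_word (us @ [a] @ vs) - free_word (us @ [b] @ vs)"
    | us c a vs where "r = free_word (us @ [c *\<^sub>C a] @ vs) - c *\<^sub>C free_word (us @ [a] @ vs)"
    unfolding multilinearity_relators_def by blast
  note r = this
  from r show "free_word ws * r \<in> multilinearity_relators"
  proof cases
    case 1
    have "free_word ws * r = free_word ((ws @ us) @ [a + b] @ vs)
      - free_word ((ws @ us) @ [a] @ vs) - free_word ((ws @ us) @ [b] @ vs)"
      unfolding 1 by (simp add: right_diff_distrib free_word_mult)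
    then show ?thesis unfolding multilinearity_relators_def by blast
  next
    case 2
    have "free_word ws * r = free_word ((ws @ us) @ [c *\<^sub>C a] @ vs)
      - c *\<^sub>C free_word ((ws @ us) @ [a] @ vs)"
      unfolding 2 by (simp add: right_diff_distrib free_word_mult scaleC_mult_free_words)
    then show ?thesis unfolding multilinearity_relators_def by blast
  qed
  from r show "r * free_word ws \<in> multilinearity_relators"
  proof cases
    case 1
    have "r * free_word ws = free_word (us @ [a + b] @ (vs @ ws))
      - free_word (us @ [a] @ (vs @ ws)) - free_word (us @ [b] @ (vs @ ws))"
      unfolding 1 by (simp add: left_diff_distrib free_word_mult)
    then show ?thesis unfolding multilinearity_relators_def by blast
  next
    case 2
    have "r * free_word ws = free_word (us @ [c *\<^sub>C a] @ (vs @ ws))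
      - c *\<^sub>C free_word (us @ [a] @ (vs @ ws))"
      unfolding 2 by (simp add: left_diff_distrib free_word_mult scaleC_mult_free_words)
    then show ?thesis unfolding multilinearity_relators_def by blast
  qed
qed

lemma relator_span_ideal:
  assumes "r \<in> cvec.span multilinearity_relators"
  shows "p * r \<in> cvec.span multilinearity_relators"
    and "r * p \<in> cvec.span multilinearity_relators"
proof -
  have *: "free_word ws * r \<in> cvec.span multilinearity_relators"
    "r * free_word ws \<in> cvec.span multilinearity_relators" for ws
    using assms
    by (induction r rule: cvec.span_induct_alt)
      (auto simp: distrib_left distrib_right scaleC_mult_free_words relators_mult_word
        intro!: cvec.span_zero cvec.span_add cvec.span_scale intro: cvec.span_base)
  show "p * r \<in> cvec.span multilinearity_relators" "r * p \<in> cvec.span multilinearity_relators"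
    by (induction p rule: free_words_induct)
      (auto simp: distrib_left distrib_right scaleC_mult_free_words *
        intro!: cvec.span_zero cvec.span_add cvec.span_scale)
qed

lemma tensor_rel_mult:
  assumes "tensor_rel p p'" "tensor_rel q q'"
  shows "tensor_rel (p * q) (p' * q')"
proof -
  have "p * q - p' * q' = (p - p') * q + p' * (q - q')"
    by (simp add: algebra_simps)
  with assms show ?thesis
    unfolding tensor_rel_def by (metis cvec.span_add relator_span_ideal)
qed

lemma lookup_relator_empty:
  assumes "r \<in> cvec.span multilinearity_relators"
  shows "Poly_Mapping.lookup r 0 = 0"
  using assms
proof (induction r rule: cvec.span_induct_alt)
  case (step c x y)
  then show ?case
    by (auto simp: multilinearity_relators_def lookup_add lookup_minus lookup_single
        scaleC_poly_mapping.rep_eq zero_word_def scaleC_complex_def)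
qed simp

instantiation tensor_algebra :: (complex_vector) "{ring_1, complex_vector}"
begin

lift_definition zero_tensor_algebra :: "'a tensor_algebra" is 0 .

lift_definition one_tensor_algebra :: "'a tensor_algebra" is 1 .

lift_definition plus_tensor_algebra ::
  "'a tensor_algebra \<Rightarrow> 'a tensor_algebra \<Rightarrow> 'a tensor_algebra" is "(+)"
  by (rule tensor_rel_add)

lift_definition uminus_tensor_algebra :: "'a tensor_algebra \<Rightarrow> 'a tensor_algebra" is uminus
  using tensor_rel_scale[of _ _ "-1"] by (simp add: cvec.scale_minus_left)

lift_definition minus_tensor_algebra ::
  "'a tensor_algebra \<Rightarrow> 'a tensor_algebra \<Rightarrow> 'a tensor_algebra" is "(-)"
  using tensor_rel_add[OF _ tensor_rel_scale[of _ _ "-1"]] by (simp add: cvec.scale_minus_left)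

lift_definition times_tensor_algebra ::
  "'a tensor_algebra \<Rightarrow> 'a tensor_algebra \<Rightarrow> 'a tensor_algebra" is "(*)"
  by (rule tensor_rel_mult)

lift_definition scaleC_tensor_algebra ::
  "complex \<Rightarrow> 'a tensor_algebra \<Rightarrow> 'a tensor_algebra" is scaleC
  by (rule tensor_rel_scale)

instance
proof
  show "(0::'a tensor_algebra) \<noteq> 1"
  proof transfer
    show "\<not> tensor_rel (0::'a free_words) 1"
    proof
      assume "tensor_rel (0::'a free_words) 1"
      from lookup_relator_empty[OF this[unfolded tensor_rel_def]] show False
        by (simp add: lookup_minus lookup_one)
    qed
  qed
qed (transfer, rule tensor_rel_eqI,
    simp add: distrib_left distrib_right mult.assoc add.assoc add.commute
      cvec.scale_right_distrib cvec.scale_left_distrib)+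

end

lift_definition pure_tensor :: "'e::complex_vector list \<Rightarrow> 'e tensor_algebra" is free_word .


section \<open>The quotient by the span of the commutators\<close>

definition commutator_span :: "'e::complex_vector tensor_algebra set"
  where "commutator_span = cvec.span {a * b - b * a | a b. True}"

definition cyclic_rel :: "'e::complex_vector tensor_algebra \<Rightarrow> 'e tensor_algebra \<Rightarrow> bool"
  where "cyclic_rel a b \<longleftrightarrow> a - b \<in> commutator_span"

quotient_type (overloaded) 'e cyclic_quotient = "'e::complex_vector tensor_algebra" / cyclic_rel
  unfolding cyclic_rel_def commutator_span_def by (rule equivp_span_diff)

lemma cyclic_rel_add:
  assumes "cyclic_rel a a'" "cyclic_rel b b'"
  shows "cyclic_rel (a + b) (a' + b')"
  using cvec.span_add[OF assms[unfolded cyclic_rel_def commutator_span_def]]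
  unfolding cyclic_rel_def commutator_span_def add_diff_add .

lemma cyclic_rel_scale:
  assumes "cyclic_rel a a'"
  shows "cyclic_rel (c *\<^sub>C a) (c *\<^sub>C a')"
  using cvec.span_scale[OF assms[unfolded cyclic_rel_def commutator_span_def], of c]
  unfolding cyclic_rel_def commutator_span_def cvec.scale_right_diff_distrib .

lemma cyclic_rel_eqI: "a = b \<Longrightarrow> cyclic_rel a b"
  by (simp add: cyclic_rel_def commutator_span_def cvec.span_zero)

instantiation cyclic_quotient :: (complex_vector) complex_vector
begin

lift_definition zero_cyclic_quotient :: "'a cyclic_quotient" is 0 .

lift_definition plus_cyclic_quotient ::
  "'a cyclic_quotient \<Rightarrow> 'a cyclic_quotient \<Rightarrow> 'a cyclic_quotient" is "(+)"
  by (rule cyclic_rel_add)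

lift_definition uminus_cyclic_quotient :: "'a cyclic_quotient \<Rightarrow> 'a cyclic_quotient" is uminus
  using cyclic_rel_scale[of _ _ "-1"] by (simp add: cvec.scale_minus_left)

lift_definition minus_cyclic_quotient ::
  "'a cyclic_quotient \<Rightarrow> 'a cyclic_quotient \<Rightarrow> 'a cyclic_quotient" is "(-)"
  using cyclic_rel_add[OF _ cyclic_rel_scale[of _ _ "-1"]] by (simp add: cvec.scale_minus_left)

lift_definition scaleC_cyclic_quotient ::
  "complex \<Rightarrow> 'a cyclic_quotient \<Rightarrow> 'a cyclic_quotient" is scaleC
  by (rule cyclic_rel_scale)

instance
  by standard
    (transfer, rule cyclic_rel_eqI,
      simp add: add.assoc add.commute cvec.scale_right_distrib cvec.scale_left_distrib)+

end

definition cyclic_class :: "'e::complex_vector tensor_algebra \<Rightarrow> 'e cyclic_quotient"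
  where "cyclic_class = abs_cyclic_quotient"

lemma cyclic_class_eq_iff: "cyclic_class a = cyclic_class b \<longleftrightarrow> a - b \<in> commutator_span"
  by (simp add: cyclic_class_def cyclic_quotient.abs_eq_iff cyclic_rel_def)


section \<open>Existence of the pairing\<close>

definition multilinear :: "('e::complex_vector list \<Rightarrow> 'v::complex_vector) \<Rightarrow> bool"
  where "multilinear f \<longleftrightarrow>
    (\<forall>us a b vs. f (us @ [a + b] @ vs) = f (us @ [a] @ vs) + f (us @ [b] @ vs)) \<and>
    (\<forall>us c a vs. f (us @ [c *\<^sub>C a] @ vs) = c *\<^sub>C f (us @ [a] @ vs))"

lemma multilinear_pure_tensor: "multilinear pure_tensor"
  unfolding multilinear_def
proof (intro conjI allI)
  fix us vs and a b :: 'a and c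
  show "pure_tensor (us @ [a + b] @ vs) = pure_tensor (us @ [a] @ vs) + pure_tensor (us @ [b] @ vs)"
  proof transfer
    fix us vs and a b :: 'a
    have "free_word (us @ [a + b] @ vs) - free_word (us @ [a] @ vs) - free_word (us @ [b] @ vs)
      \<in> multilinearity_relators"
      unfolding multilinearity_relators_def by blast
    then show "tensor_rel (free_word (us @ [a + b] @ vs))
      (free_word (us @ [a] @ vs) + free_word (us @ [b] @ vs))"
      unfolding tensor_rel_def diff_diff_eq by (rule cvec.span_base)
  qed
  show "pure_tensor (us @ [c *\<^sub>C a] @ vs) = c *\<^sub>C pure_tensor (us @ [a] @ vs)"
  proof transfer
    fix us vs c and a :: 'a
    have "free_word (us @ [c *\<^sub>C a] @ vs) - c *\<^sub>C free_word (us @ [a] @ vs)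
      \<in> multilinearity_relators"
      unfolding multilinearity_relators_def by blast
    then show "tensor_rel (free_word (us @ [c *\<^sub>C a] @ vs)) (c *\<^sub>C free_word (us @ [a] @ vs))"
      unfolding tensor_rel_def by (rule cvec.span_base)
  qed
qed

lemma pure_tensor_mult: "pure_tensor us * pure_tensor vs = pure_tensor (us @ vs)"
  by transfer (simp only: free_word_mult tensor_rel_refl)

lemma pure_tensor_Nil: "pure_tensor [] = 1"
  by transfer (simp add: tensor_rel_refl flip: zero_word_def)

lemma tensor_algebra_induct [case_names zero add]:
  assumes "P 0" "\<And>c us p. P p \<Longrightarrow> P (c *\<^sub>C pure_tensor us + p)"
  shows "P (t :: 'e::complex_vector tensor_algebra)"
proof (induction t rule: tensor_algebra.abs_induct)
  case (1 p)
  show ?case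
  proof (induction p rule: free_words_induct)
    case zero
    then show ?case using assms(1) by (simp add: zero_tensor_algebra.abs_eq)
  next
    case (add c us p)
    from assms(2)[OF this, of c us] show ?case
      by (simp add: pure_tensor.abs_eq scaleC_tensor_algebra.abs_eq plus_tensor_algebra.abs_eq)
  qed
qed

lemma cbilinear_pure_tensor_eqI:
  assumes "cbilinear A" "cbilinear B"
    "\<And>us vs. A (pure_tensor us) (pure_tensor vs) = B (pure_tensor us) (pure_tensor vs)"
  shows "A = B"
proof (intro ext)
  have lin: "clinear (A s)" "clinear (B s)" "clinear (\<lambda>s. A s t)" "clinear (\<lambda>s. B s t)" for s t
    using assms(1,2) by (auto simp: cbilinear_def)
  have *: "A (pure_tensor us) t = B (pure_tensor us) t" for us t
  proof (induction t rule: tensor_algebra_induct)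
    case zero
    show ?case using clinear_zero[OF lin(1)] clinear_zero[OF lin(2)] by simp
  next
    case (add c vs p)
    then show ?case using lin(1,2)[of "pure_tensor us"] by (simp add: clinear_iff assms(3))
  qed
  show "A s t = B s t" for s t
  proof (induction s rule: tensor_algebra_induct)
    case zero
    show ?case using clinear_zero[OF lin(3)] clinear_zero[OF lin(4)] by simp
  next
    case (add c us p)
    then show ?case using lin(3,4)[of t] by (simp add: clinear_iff *)
  qed
qed

definition free_extension :: "('e list \<Rightarrow> 'v) \<Rightarrow> 'e free_words \<Rightarrow> 'v::complex_vector"
  where "free_extension f p = (\<Sum>w\<in>Poly_Mapping.keys p. Poly_Mapping.lookup p w *\<^sub>C f (letters w))"

lemma free_extension_superset:
  assumes "finite W" "Poly_Mapping.keys p \<subseteq> W"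
  shows "free_extension f p = (\<Sum>w\<in>W. Poly_Mapping.lookup p w *\<^sub>C f (letters w))"
  unfolding free_extension_def
  by (rule sum.mono_neutral_left) (use assms in \<open>auto simp: in_keys_iff\<close>)

lemma free_extension_add: "free_extension f (p + q) = free_extension f p + free_extension f q"
proof -
  let ?W = "Poly_Mapping.keys p \<union> Poly_Mapping.keys q"
  have "Poly_Mapping.keys (p + q) \<subseteq> ?W" by (rule Poly_Mapping.keys_add)
  then show ?thesis
    by (simp add: free_extension_superset[of ?W] lookup_add scaleC_add_left sum.distrib)
qed

lemma free_extension_scale: "free_extension f (c *\<^sub>C p) = c *\<^sub>C free_extension f p"
proof -
  have "Poly_Mapping.keys (c *\<^sub>C p) \<subseteq> Poly_Mapping.keys p"
    by (auto simp: in_keys_iff scaleC_poly_mapping.rep_eq)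
  then show ?thesis
    by (simp add: free_extension_superset[of "Poly_Mapping.keys p"] scaleC_poly_mapping.rep_eq
        cvec.scale_sum_right scaleC_complex_def)
qed

lemma free_extension_diff: "free_extension f (p - q) = free_extension f p - free_extension f q"
  using free_extension_add[of f "p - q" q] by simp

lemma free_extension_word: "free_extension f (free_word us) = f us"
  by (simp add: free_extension_def scaleC_one)

lemma free_extension_relator:
  assumes "multilinear f" "r \<in> cvec.span multilinearity_relators"
  shows "free_extension f r = 0"
  using assms(2)
proof (induction r rule: cvec.span_induct_alt)
  case base
  then show ?case by (simp add: free_extension_def)
next
  case (step c x y)
  have "free_extension f x = 0"
    using step(1) assms(1) unfolding multilinearity_relators_def multilinear_def
    by (auto simp: free_extension_diff free_extension_scale free_extension_word simp del: append.simps append_Cons)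
  with step(2) show ?case by (simp add: free_extension_add free_extension_scale)
qed

text \<open>The universal property of the tensor powers.\<close>

lemma multilinear_extension:
  assumes "multilinear f"
  shows "\<exists>F. clinear F \<and> (\<forall>us. F (pure_tensor us) = f us)"
proof (intro exI conjI allI)
  define F where "F t = free_extension f (rep_tensor_algebra t)" for t
  have F_abs: "F (abs_tensor_algebra p) = free_extension f p" for p
  proof -
    have "tensor_rel (rep_tensor_algebra (abs_tensor_algebra p)) p"
      by (rule Quotient3_rep_abs[OF Quotient3_tensor_algebra tensor_rel_refl])
    from free_extension_relator[OF assms this[unfolded tensor_rel_def]] show ?thesis
      by (simp add: F_def free_extension_diff)
  qed
  show "F (pure_tensor us) = f us" for us
    by (simp add: pure_tensor.abs_eq F_abs free_extension_word)
  have "F (s + t) = F s + F t" for s t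
    by (induction s rule: tensor_algebra.abs_induct, induction t rule: tensor_algebra.abs_induct)
      (simp add: plus_tensor_algebra.abs_eq F_abs free_extension_add)
  moreover have "F (c *\<^sub>C s) = c *\<^sub>C F s" for c s
    by (induction s rule: tensor_algebra.abs_induct)
      (simp add: scaleC_tensor_algebra.abs_eq F_abs free_extension_scale)
  ultimately show "clinear F" by (simp add: clinear_iff)
qed

definition rotate_out :: "'a list \<Rightarrow> nat \<Rightarrow> 'a list"
  where "rotate_out us i = drop (Suc i) us @ take i us"

lemma multilinear_rotate_out:
  assumes lin: "clinear g"
  shows "multilinear (\<lambda>us. \<Sum>i<length us. g (us ! i) *\<^sub>C pure_tensor (ps @ rotate_out us i @ qs))"
proof -
  have pt: "multilinear (pure_tensor :: 'a list \<Rightarrow> 'a tensor_algebra)"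
    by (rule multilinear_pure_tensor)
  have add: "pure_tensor (us @ (a + b) # vs) = pure_tensor (us @ a # vs) + pure_tensor (us @ b # vs)"
    and scale: "pure_tensor (us @ (c *\<^sub>C a) # vs) = c *\<^sub>C pure_tensor (us @ a # vs)"
    for us vs c and a b :: 'a
    using pt unfolding multilinear_def by simp_all
  have g: "g (a + b) = g a + g b" "g (c *\<^sub>C a) = c * g a" for a b c
    using lin by (auto simp: clinear_iff scaleC_complex_def)
  have A: "g ((us @ (a + b) # vs) ! i) *\<^sub>C pure_tensor (ps @ rotate_out (us @ (a + b) # vs) i @ qs) =
      g ((us @ a # vs) ! i) *\<^sub>C pure_tensor (ps @ rotate_out (us @ a # vs) i @ qs) +
      g ((us @ b # vs) ! i) *\<^sub>C pure_tensor (ps @ rotate_out (us @ b # vs) i @ qs)" (is ?A)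
    and S: "g ((us @ (c *\<^sub>C a) # vs) ! i) *\<^sub>C pure_tensor (ps @ rotate_out (us @ (c *\<^sub>C a) # vs) i @ qs) =
      c *\<^sub>C g ((us @ a # vs) ! i) *\<^sub>C pure_tensor (ps @ rotate_out (us @ a # vs) i @ qs)" (is ?S)
    for us vs c i and a b :: 'a
  proof -
    consider "i < length us" | "i = length us" | k where "i = Suc (length us + k)"
      by (metis less_imp_Suc_add linorder_neqE_nat)
    then have "?A \<and> ?S"
    proof cases
      case 1
      have ro: "ps @ rotate_out (us @ z # vs) i @ qs
          = (ps @ drop (Suc i) us) @ z # (vs @ take i us @ qs)" for z
        using 1 by (simp add: rotate_out_def)
      show ?thesis unfolding ro add scale
        using 1 by (simp add: nth_append scaleC_add_right scaleC_scaleC mult.commute)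
    next
      case 2
      have ro: "ps @ rotate_out (us @ z # vs) i @ qs = ps @ vs @ us @ qs" for z
        using 2 by (simp add: rotate_out_def)
      show ?thesis unfolding ro using 2 by (simp add: nth_append g scaleC_add_left scaleC_scaleC)
    next
      case 3
      have ro: "ps @ rotate_out (us @ z # vs) i @ qs
          = (ps @ drop (Suc k) vs @ us) @ z # (take k vs @ qs)" for z
        using 3 by (simp add: rotate_out_def Suc_diff_le)
      show ?thesis unfolding ro add scale
        using 3 by (simp add: nth_append scaleC_add_right scaleC_scaleC mult.commute)
    qed
    then show ?A ?S by blast+
  qed
  show ?thesis
    unfolding multilinear_def
    by (simp add: A S sum.distrib cvec.scale_sum_right del: sum.lessThan_Suc)
qed

text \<open>
  The values on pure tensors are indexed from \<open>0\<close>, so that \<open>us ! i\<close> is \<open>u\<^sub>i\<^sub>+\<^sub>1\<close>; they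
  determine one and only one bilinear pairing.
\<close>

lemma pairing_exists:
  assumes "cbilinear \<omega>"
  shows "\<exists>!B. cbilinear B \<and> (\<forall>us vs. B (pure_tensor us) (pure_tensor vs) =
      (\<Sum>i<length us. \<Sum>j<length vs. \<omega> (us ! i) (vs ! j) *\<^sub>C
        pure_tensor (drop (Suc i) us @ take i us @ drop (Suc j) vs @ take j vs)))"
proof -
  define G where "G us vs = (\<Sum>i<length us. \<Sum>j<length vs. \<omega> (us ! i) (vs ! j) *\<^sub>C
        pure_tensor (drop (Suc i) us @ take i us @ drop (Suc j) vs @ take j vs))" for us vs
  have G_left: "G us vs = (\<Sum>j<length vs. \<Sum>i<length us. \<omega> (us ! i) (vs ! j) *\<^sub>C
        pure_tensor ([] @ rotate_out us i @ rotate_out vs j))" for us vs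
    unfolding G_def rotate_out_def by (subst sum.swap) simp
  have G_right: "G us vs = (\<Sum>i<length us. \<Sum>j<length vs. \<omega> (us ! i) (vs ! j) *\<^sub>C
        pure_tensor (rotate_out us i @ rotate_out vs j @ []))" for us vs
    unfolding G_def rotate_out_def by simp
  have sum: "multilinear (\<lambda>us. \<Sum>k\<in>K. f k us)" if "\<And>k. multilinear (f k)"
    for f :: "nat \<Rightarrow> 'x::complex_vector list \<Rightarrow> 'y::complex_vector" and K
    using that unfolding multilinear_def by (simp add: sum.distrib cvec.scale_sum_right)
  have left: "multilinear (\<lambda>us. G us vs)" for vs
    unfolding G_left
    by (intro sum multilinear_rotate_out) (use assms in \<open>auto simp: cbilinear_def\<close>)
  have right: "multilinear (G us)" for us
    unfolding G_right
    by (intro sum multilinear_rotate_out) (use assms in \<open>auto simp: cbilinear_def\<close>)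
  obtain R where R: "clinear (R us)" "R us (pure_tensor vs) = G us vs" for us vs
    using multilinear_extension[OF right] by metis
  have "multilinear (\<lambda>us. R us t)" for t
  proof (induction t rule: tensor_algebra_induct)
    case zero
    have "R us 0 = 0" for us
      using R(1)[of us] by (metis add_cancel_right_right clinear_iff)
    then show ?case by (simp add: multilinear_def)
  next
    case (add c vs p)
    have eq: "R us (c *\<^sub>C pure_tensor vs + p) = c *\<^sub>C G us vs + R us p" for us
      using R(1)[of us] by (simp add: clinear_iff R(2))
    from left[of vs] add show ?case
      unfolding eq multilinear_def
      by (simp add: scaleC_add_right scaleC_scaleC mult.commute)
  qed
  from multilinear_extension[OF this] obtain L
    where L: "clinear (L t)" "L t (pure_tensor us) = R us t" for t us
    by metis
  define B where "B s t = L t s" for s t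
  have "clinear (B s)" for s
  proof (induction s rule: tensor_algebra_induct)
    case zero
    have "B 0 t = 0" for t
      unfolding B_def using L(1)[of t] by (metis add_cancel_right_right clinear_iff)
    then show ?case by (simp add: clinear_iff)
  next
    case (add c us p)
    have eq: "B (c *\<^sub>C pure_tensor us + p) t = c *\<^sub>C R us t + B p t" for t
      unfolding B_def using L(1)[of t] by (simp add: clinear_iff L(2))
    from R(1)[of us] add show ?case
      unfolding clinear_iff eq
      by (simp add: scaleC_add_right scaleC_scaleC mult.commute)
  qed
  then have "cbilinear B"
    using L(1) by (simp add: cbilinear_def B_def)
  moreover have "B (pure_tensor us) (pure_tensor vs) = G us vs" for us vs
    by (simp add: B_def L R)
  ultimately show ?thesis
    unfolding G_def by (intro ex1I[of _ B]) (auto intro: cbilinear_pure_tensor_eqI)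
qed

end

theory Submission
  imports Defs
begin

text \<open>
  The pairing is a sum over all rotations of its two arguments: a rotated word contributes its first
  letter, which is contracted by \<open>\<omega>\<close>, and the remaining letters. A sum over all rotations does not
  change when the word is rotated (\<open>rotation_sum_rotate\<close>), so the pairing takes the same value at
  \<open>a \<cdot> b\<close> and \<open>b \<cdot> a\<close> in either argument. Hence it vanishes on commutators
  (\<open>B_commutator_span\<close>) and descends to the quotient. In the quotient the values may be rotated too,
  and the antisymmetry of \<open>\<omega>\<close> gives that of the bracket (\<open>bracket_self\<close>).

  For the Jacobi identity think of the quotient as spanned by necklaces, the bracket being the sum
  over all ways to remove a bead from each of two necklaces, to weight the result with \<open>\<omega>\<close> of the
  two beads and to join the open ends. In \<open>{u, {v, w}}\<close> one joins \<open>v\<close> to \<open>w\<close> and then \<open>u\<close> at a bead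
  that comes from \<open>v\<close> or from \<open>w\<close>. Let \<open>chain u v w\<close> be the part in which that bead comes from \<open>v\<close>:
  it is a sum over all ordered pairs of distinct beads of the middle necklace \<open>v\<close>, one of them
  contracted with \<open>u\<close> and the other one with \<open>w\<close>. The other part has \<open>w\<close> in the middle, with the
  contraction of \<open>v\<close> and \<open>w\<close> in the opposite order, so
  \<open>{u, {v, w}} = chain u v w - chain u w v\<close> (\<open>bracket_bracket_necklace\<close>). Exchanging the two beads
  of the middle necklace, and the arguments of both contractions, gives
  \<open>chain u v w = chain w v u\<close> (\<open>chain_reverse\<close>), and the six terms of the Jacobi sum cancel in
  pairs.
\<close>

section \<open>Sums over the rotations of a word\<close>

definition rotation_sum :: "('a list \<Rightarrow> 'v::comm_monoid_add) \<Rightarrow> 'a list \<Rightarrow> 'v"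
  where "rotation_sum h us = (\<Sum>i<length us. h (rotate i us))"

lemma rotation_sum_rotate1:
  "rotation_sum h (rotate1 us) = rotation_sum h us"
proof (cases us)
  case (Cons a us')
  have "rotation_sum h (rotate1 us) = (\<Sum>i<length us. h (rotate (Suc i) us))"
    by (simp add: rotation_sum_def rotate1_rotate_swap)
  also have "\<dots> = (\<Sum>i<length us'. h (rotate (Suc i) us)) + h (rotate (length us) us)"
    by (simp add: Cons)
  also have "h (rotate (length us) us) = h (rotate 0 us)"
    by simp
  also have "(\<Sum>i<length us'. h (rotate (Suc i) us)) + h (rotate 0 us) = rotation_sum h us"
    by (simp only: rotation_sum_def Cons length_Cons sum.lessThan_Suc_shift add.commute)
  finally show ?thesis .
qed simp

lemma rotation_sum_rotate: "rotation_sum h (rotate k us) = rotation_sum h us"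
  by (induction k) (simp_all add: rotation_sum_rotate1)

lemma rotation_sum_append_commute: "rotation_sum h (us @ vs) = rotation_sum h (vs @ us)"
  by (metis rotate_append rotation_sum_rotate)

lemma rotation_sum_cong:
  assumes "\<And>u. length u = length us \<Longrightarrow> h u = h' u"
  shows "rotation_sum h us = rotation_sum h' us"
  by (simp add: rotation_sum_def assms)

lemma rotation_sum_swap:
  "rotation_sum (\<lambda>u. rotation_sum (\<lambda>v. h u v) vs) us =
    rotation_sum (\<lambda>v. rotation_sum (\<lambda>u. h u v) us) vs"
  unfolding rotation_sum_def by (rule sum.swap)

lemma rotation_sum_add:
  "rotation_sum (\<lambda>u. h u + h' u) us = rotation_sum h us + rotation_sum h' us"
  by (simp add: rotation_sum_def sum.distrib)

lemma rotation_sum_minus: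
  "rotation_sum (\<lambda>u. - h u) us = - rotation_sum h us" for h :: "_ \<Rightarrow> 'v::ab_group_add"
  by (simp add: rotation_sum_def sum_negf)

lemma clinear_sum: "clinear f \<Longrightarrow> f (sum g A) = (\<Sum>a\<in>A. f (g a))"
  by (induction A rule: infinite_finite_induct) (simp_all add: clinear_zero clinear_iff)

lemma clinear_rotation_sum:
  "clinear f \<Longrightarrow> f (rotation_sum h us) = rotation_sum (\<lambda>u. f (h u)) us"
  by (simp add: rotation_sum_def clinear_sum)

text \<open>
  The bridge from positions to rotations: the letter at position \<open>i\<close> and the letters that follow it
  cyclically are the head and the tail of the word rotated by \<open>i\<close>.
\<close>

lemma rotation_sum_nth:
  "(\<Sum>i<length us. h (us ! i) (drop (Suc i) us @ take i us)) = rotation_sum (\<lambda>u. h (hd u) (tl u)) us"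
  unfolding rotation_sum_def
proof (rule sum.cong)
  fix i assume "i \<in> {..<length us}"
  then have "rotate i us = us ! i # drop (Suc i) us @ take i us"
    by (simp add: rotate_drop_take flip: Cons_nth_drop_Suc)
  then show "h (us ! i) (drop (Suc i) us @ take i us) = h (hd (rotate i us)) (tl (rotate i us))"
    by simp
qed simp

text \<open>
  Up to rotation, a necklace with an ordered pair of distinct beads \<open>a\<close> and \<open>b\<close> singled out is
  \<open>a # P @ b # Q\<close>; the summand gets each bead together with the segment that follows it.
\<close>

definition bead_pair_sum ::
  "('a \<Rightarrow> 'a list \<Rightarrow> 'a \<Rightarrow> 'a list \<Rightarrow> 'v::comm_monoid_add) \<Rightarrow> 'a list \<Rightarrow> 'v"
  where "bead_pair_sum f = rotation_sum
    (\<lambda>v. \<Sum>m<length (tl v). f (hd v) (take m (tl v)) (tl v ! m) (drop (Suc m) (tl v)))"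

text \<open>
  Rotating \<open>a # P @ b # Q\<close> by \<open>Suc (length P)\<close> steps gives \<open>b # Q @ a # P\<close>, so the exchange of
  the beads is a rotation followed by reversing the order of the possible lengths of \<open>P\<close>.
\<close>

lemma bead_pair_sum_swap:
  fixes f :: "'a \<Rightarrow> 'a list \<Rightarrow> 'a \<Rightarrow> 'a list \<Rightarrow> 'v::comm_monoid_add"
  shows "bead_pair_sum f vs = bead_pair_sum (\<lambda>a P b Q. f b Q a P) vs"
proof -
  define n where "n = length vs - 1"
  define h where "h f m v = f (hd v) (take m (tl v)) (tl v ! m) (drop (Suc m) (tl v))"
    for f :: "'a \<Rightarrow> 'a list \<Rightarrow> 'a \<Rightarrow> 'a list \<Rightarrow> 'v" and m v
  have sum_h: "bead_pair_sum f vs = (\<Sum>m<n. rotation_sum (h f m) vs)"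
    for f :: "'a \<Rightarrow> 'a list \<Rightarrow> 'a \<Rightarrow> 'a list \<Rightarrow> 'v"
    unfolding bead_pair_sum_def rotation_sum_def h_def n_def by (subst sum.swap) simp
  let ?f' = "\<lambda>a P b Q. f b Q a P"
  have h_rotate: "h f m v = h ?f' (n - Suc m) (rotate (Suc m) v)"
    if "m < n" "length v = length vs" for m v
  proof -
    from that obtain a xs where v: "v = a # xs" and len: "length xs = n"
      by (cases v) (auto simp: n_def)
    have "xs = take m xs @ xs ! m # drop (Suc m) xs"
      using that(1) len by (simp add: id_take_nth_drop)
    then have "v = (a # take m xs) @ xs ! m # drop (Suc m) xs"
      by (simp add: v)
    moreover have "length (a # take m xs) = Suc m"
      using that(1) len by simp
    ultimately have "rotate (Suc m) v = (xs ! m # drop (Suc m) xs) @ a # take m xs"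
      by (metis rotate_append)
    moreover have "length (drop (Suc m) xs) = n - Suc m"
      by (simp add: len)
    ultimately show ?thesis
      by (simp add: h_def v nth_append del: drop_Suc)
  qed
  have "bead_pair_sum f vs = (\<Sum>m<n. rotation_sum (\<lambda>v. h ?f' (n - Suc m) (rotate (Suc m) v)) vs)"
    unfolding sum_h by (intro sum.cong refl rotation_sum_cong h_rotate) auto
  also have "\<dots> = (\<Sum>m<n. rotation_sum (h ?f' (n - Suc m)) (rotate (Suc m) vs))"
    by (simp add: rotation_sum_def rotate_rotate add.commute del: rotate_Suc)
  also have "\<dots> = (\<Sum>m<n. rotation_sum (h ?f' (n - Suc m)) vs)"
    by (simp only: rotation_sum_rotate)
  also have "\<dots> = bead_pair_sum ?f' vs"
    unfolding sum_h by (rule sum.nat_diff_reindex)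
  finally show ?thesis .
qed


section \<open>The space of necklaces\<close>

lemma clinear_pure_tensor_eq_0:
  assumes "clinear f" "\<And>us. f (pure_tensor us) = 0"
  shows "f t = 0"
proof (induction t rule: tensor_algebra_induct)
  case zero
  then show ?case using assms(1) by (rule clinear_zero)
next
  case (add c us p)
  then show ?case using assms by (simp add: clinear_iff)
qed

lemma trilinear_pure_tensor_eq_0:
  assumes "\<And>b c. clinear (\<lambda>a. f a b c)" "\<And>a c. clinear (\<lambda>b. f a b c)" "\<And>a b. clinear (f a b)"
    and "\<And>us vs ws. f (pure_tensor us) (pure_tensor vs) (pure_tensor ws) = 0"
  shows "f a b c = 0"
proof -
  have "f (pure_tensor us) (pure_tensor vs) c = 0" for us vs
    using assms(3,4) by (rule clinear_pure_tensor_eq_0)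
  then have "f (pure_tensor us) b c = 0" for us
    by (rule clinear_pure_tensor_eq_0[OF assms(2)])
  then show ?thesis
    by (rule clinear_pure_tensor_eq_0[OF assms(1)])
qed

lemma clinear_cyclic_class: "clinear cyclic_class"
  by (simp add: clinear_iff cyclic_class_def plus_cyclic_quotient.abs_eq scaleC_cyclic_quotient.abs_eq)

lemma cyclic_class_surj: "\<exists>a. \<alpha> = cyclic_class a"
  unfolding cyclic_class_def by (induction \<alpha> rule: cyclic_quotient.abs_induct) auto

lemma tensor_scaleC_mult:
  "(c *\<^sub>C s) * t = c *\<^sub>C (s * t)" "s * (c *\<^sub>C t) = c *\<^sub>C (s * t)" for s t :: "'e::complex_vector tensor_algebra"
  by (transfer, simp add: scaleC_mult_free_words tensor_rel_refl)+

text \<open>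
  The commutators of words span all commutators, because the product is bilinear and words span the
  tensor algebra.
\<close>

lemma clinear_commutator_span_eq_0:
  assumes f: "clinear f" and rotate: "\<And>us vs. f (pure_tensor (us @ vs)) = f (pure_tensor (vs @ us))"
    and "t \<in> commutator_span"
  shows "f t = 0"
proof -
  have f_simps: "f (s + t) = f s + f t" "f (c *\<^sub>C s) = c *\<^sub>C f s" "f 0 = 0" for c s t
    using f clinear_zero by (auto simp: clinear_iff)
  have pure_left: "f (pure_tensor us * b) = f (b * pure_tensor us)" for us b
    by (induction b rule: tensor_algebra_induct)
      (simp_all add: algebra_simps tensor_scaleC_mult pure_tensor_mult f_simps rotate[of us])
  have commute: "f (a * b) = f (b * a)" for a b
    by (induction a rule: tensor_algebra_induct)
      (simp_all add: algebra_simps tensor_scaleC_mult f_simps pure_left)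
  have diff: "f (s - t) = f s - f t" for s t
    using f_simps(1)[of "s - t" t] by simp
  show ?thesis
    using assms(3) unfolding commutator_span_def
    by (induction t rule: cvec.span_induct_alt) (auto simp: f_simps diff commute)
qed

definition necklace :: "'e::complex_vector list \<Rightarrow> 'e cyclic_quotient"
  where "necklace us = cyclic_class (pure_tensor us)"

lemma necklace_append_commute: "necklace (us @ vs) = necklace (vs @ us)"
proof -
  have "pure_tensor (us @ vs) - pure_tensor (vs @ us) \<in> commutator_span"
    unfolding commutator_span_def pure_tensor_mult[symmetric] by (rule cvec.span_base) blast
  then show ?thesis
    by (simp add: necklace_def cyclic_class_eq_iff)
qed

lemma eq_0_if_eq_minus:
  fixes a :: "'a::complex_vector"
  assumes "a = - a"
  shows "a = 0"
proof -
  have "2 *\<^sub>C a = a + a"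
    by (metis one_add_one scaleC_add_left scaleC_one)
  also have "\<dots> = 0"
    using assms by (simp add: eq_neg_iff_add_eq_0)
  finally show ?thesis
    by simp
qed

section \<open>The pairing of necklaces\<close>

locale necklace_pairing =
  fixes \<omega> :: "'e::complex_vector \<Rightarrow> 'e \<Rightarrow> complex"
    and B :: "'e tensor_algebra \<Rightarrow> 'e tensor_algebra \<Rightarrow> 'e tensor_algebra"
  assumes bilinear_form: "cbilinear \<omega>" and alternating: "\<omega> u u = 0"
    and bilinear: "cbilinear B"
    and pure: "B (pure_tensor us) (pure_tensor vs) =
      (\<Sum>i<length us. \<Sum>j<length vs. \<omega> (us ! i) (vs ! j) *\<^sub>C
        pure_tensor (drop (Suc i) us @ take i us @ drop (Suc j) vs @ take j vs))"
begin

lemma antisymmetric: "\<omega> u v = - \<omega> v u"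
proof -
  have "\<omega> (u + v) (u + v) = \<omega> u u + \<omega> u v + (\<omega> v u + \<omega> v v)"
    using bilinear_form by (simp add: cbilinear_def clinear_iff)
  then show ?thesis
    by (simp add: alternating eq_neg_iff_add_eq_0)
qed

lemma B_linear: "clinear (B a)" "clinear (\<lambda>a. B a b)"
  using bilinear by (simp_all add: cbilinear_def)

lemmas B_simps = B_linear[unfolded clinear_iff, THEN conjunct1, rule_format]
  B_linear[unfolded clinear_iff, THEN conjunct2, rule_format]

lemma B_diff: "B a (b - b') = B a b - B a b'" "B (a - a') b = B a b - B a' b"
  by (metis B_simps(1) add_diff_cancel diff_add_cancel) (metis B_simps(2) add_diff_cancel diff_add_cancel)

lemma B_pure_rotation_sum:
  "B (pure_tensor us) (pure_tensor vs) =
    rotation_sum (\<lambda>u. rotation_sum (\<lambda>v. \<omega> (hd u) (hd v) *\<^sub>C pure_tensor (tl u @ tl v)) vs) us"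
proof -
  have right: "(\<Sum>j<length vs. \<omega> a (vs ! j) *\<^sub>C pure_tensor (us' @ drop (Suc j) vs @ take j vs)) =
      rotation_sum (\<lambda>v. \<omega> a (hd v) *\<^sub>C pure_tensor (us' @ tl v)) vs" for a us'
    by (rule rotation_sum_nth[where h = "\<lambda>b vs'. \<omega> a b *\<^sub>C pure_tensor (us' @ vs')"])
  show ?thesis
    unfolding pure rotation_sum_nth[symmetric, where
        h = "\<lambda>a us'. rotation_sum (\<lambda>v. \<omega> a (hd v) *\<^sub>C pure_tensor (us' @ tl v)) vs"]
    unfolding right[symmetric] unfolding append_assoc ..
qed


text \<open>
  On words both slots enter through a sum over all rotations, which does not see a rotation of the
  word. So already the pairing in the tensor algebra, and not only its class in the quotient,
  vanishes on commutators.
\<close>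

lemma B_commutator_span:
  assumes "t \<in> commutator_span"
  shows "B t c = 0" "B c t = 0"
proof -
  have "B t (pure_tensor ws) = 0" for ws
    using B_linear(2) _ assms
    by (rule clinear_commutator_span_eq_0) (simp only: B_pure_rotation_sum rotation_sum_append_commute)
  then show "B t c = 0"
    by (rule clinear_pure_tensor_eq_0[OF B_linear(1)])
  have "B (pure_tensor ws) t = 0" for ws
    using B_linear(1) _ assms
    by (rule clinear_commutator_span_eq_0)
      (simp only: B_pure_rotation_sum rotation_sum_append_commute[of _ us vs for us vs])
  then show "B c t = 0"
    by (rule clinear_pure_tensor_eq_0[OF B_linear(2)])
qed

definition bracket :: "'e cyclic_quotient \<Rightarrow> 'e cyclic_quotient \<Rightarrow> 'e cyclic_quotient"
  where "bracket \<alpha> \<beta> = cyclic_class (B (rep_cyclic_quotient \<alpha>) (rep_cyclic_quotient \<beta>))"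

lemma bracket_class: "bracket (cyclic_class a) (cyclic_class b) = cyclic_class (B a b)"
proof -
  have rep: "rep_cyclic_quotient (cyclic_class a) - a \<in> commutator_span" for a :: "'e tensor_algebra"
    unfolding cyclic_class_eq_iff[symmetric] by (simp add: cyclic_class_def Quotient3_abs_rep[OF Quotient3_cyclic_quotient])
  have "B (rep_cyclic_quotient (cyclic_class a)) c = B a c"
    and "B c (rep_cyclic_quotient (cyclic_class b)) = B c b" for c
    using B_commutator_span[OF rep] by (simp_all add: B_diff)
  then show ?thesis
    by (simp add: bracket_def)
qed

lemma cyclic_class_simps:
  "cyclic_class (a + b) = cyclic_class a + cyclic_class b"
  "cyclic_class (c *\<^sub>C a) = c *\<^sub>C cyclic_class a"
  "cyclic_class 0 = 0"
  using clinear_cyclic_class clinear_zero by (auto simp: clinear_iff)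

lemma bracket_linear:
  "clinear (bracket \<alpha>)" "clinear (\<lambda>\<alpha>. bracket \<alpha> \<beta>)"
proof -
  have add: "bracket \<alpha> (\<beta> + \<gamma>) = bracket \<alpha> \<beta> + bracket \<alpha> \<gamma>"
      "bracket (\<beta> + \<gamma>) \<alpha> = bracket \<beta> \<alpha> + bracket \<gamma> \<alpha>"
    and scale: "bracket \<alpha> (c *\<^sub>C \<beta>) = c *\<^sub>C bracket \<alpha> \<beta>"
      "bracket (c *\<^sub>C \<beta>) \<alpha> = c *\<^sub>C bracket \<beta> \<alpha>"
    for \<alpha> \<beta> \<gamma> c
  proof -
    obtain a b d where "\<alpha> = cyclic_class a" "\<beta> = cyclic_class b" "\<gamma> = cyclic_class d"
      using cyclic_class_surj by metis
    then show "bracket \<alpha> (\<beta> + \<gamma>) = bracket \<alpha> \<beta> + bracket \<alpha> \<gamma>"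
      "bracket (\<beta> + \<gamma>) \<alpha> = bracket \<beta> \<alpha> + bracket \<gamma> \<alpha>"
      "bracket \<alpha> (c *\<^sub>C \<beta>) = c *\<^sub>C bracket \<alpha> \<beta>" "bracket (c *\<^sub>C \<beta>) \<alpha> = c *\<^sub>C bracket \<beta> \<alpha>"
      by (simp_all add: bracket_class B_simps flip: cyclic_class_simps)
  qed
  show "clinear (bracket \<alpha>)" "clinear (\<lambda>\<alpha>. bracket \<alpha> \<beta>)"
    by (simp_all add: clinear_iff add scale)
qed

lemma bracket_necklace:
  "bracket (necklace us) (necklace vs) =
    rotation_sum (\<lambda>u. rotation_sum (\<lambda>v. \<omega> (hd u) (hd v) *\<^sub>C necklace (tl u @ tl v)) vs) us"
  by (simp add: necklace_def bracket_class B_pure_rotation_sum clinear_rotation_sum[OF clinear_cyclic_class]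
      cyclic_class_simps)

lemma bracket_self: "bracket \<alpha> \<alpha> = 0"
proof (rule eq_0_if_eq_minus)
  have "(\<lambda>a b. cyclic_class (B a b)) = (\<lambda>a b. - cyclic_class (B b a))"
  proof (rule cbilinear_pure_tensor_eqI)
    fix us vs
    have pointwise: "\<omega> (hd u) (hd v) *\<^sub>C necklace (tl u @ tl v) = - (\<omega> (hd v) (hd u) *\<^sub>C necklace (tl v @ tl u))" for u v
      by (simp add: antisymmetric[of "hd u" "hd v"] necklace_append_commute[of "tl u" "tl v"])
    have "bracket (necklace us) (necklace vs) = - bracket (necklace vs) (necklace us)"
      unfolding bracket_necklace rotation_sum_swap[of _ vs us] rotation_sum_minus[symmetric]
      by (intro rotation_sum_cong pointwise)
    then show "cyclic_class (B (pure_tensor us) (pure_tensor vs)) = - cyclic_class (B (pure_tensor vs) (pure_tensor us))"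
      by (simp add: necklace_def bracket_class)
  qed (simp_all add: cbilinear_def clinear_iff B_simps cyclic_class_simps)
  then have "cyclic_class (B a a) = - cyclic_class (B a a)" for a
    by meson
  moreover obtain a where "\<alpha> = cyclic_class a"
    using cyclic_class_surj by blast
  ultimately show "bracket \<alpha> \<alpha> = - bracket \<alpha> \<alpha>"
    by (simp add: bracket_class)
qed


section \<open>The Jacobi identity\<close>

text \<open>
  The necklace formed by \<open>xs @ ys\<close> is joined to \<open>us\<close> at a bead of \<open>xs\<close>. The segment \<open>ys\<close> stays in one
  piece; in the use below it is what remains of a third necklace joined to \<open>xs\<close> before.
\<close>

definition glue :: "'e list \<Rightarrow> 'e list \<Rightarrow> 'e list \<Rightarrow> 'e cyclic_quotient"
  where "glue us xs ys = rotation_sum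
    (\<lambda>u. \<Sum>m<length xs. \<omega> (hd u) (xs ! m) *\<^sub>C necklace (tl u @ drop (Suc m) xs @ ys @ take m xs)) us"

lemma bracket_necklace_append:
  "bracket (necklace us) (necklace (xs @ ys)) = glue us xs ys + glue us ys xs"
proof -
  let ?p = "length xs" and ?q = "length ys"
  have split: "(\<Sum>m<p + q. f m) = (\<Sum>m<p. f m) + (\<Sum>m<q. f (p + m))"
    for f :: "nat \<Rightarrow> 'e cyclic_quotient" and p q
    by (induction q) (simp_all add: add.assoc)
  have "rotation_sum (\<lambda>v. \<omega> (hd u) (hd v) *\<^sub>C necklace (tl u @ tl v)) (xs @ ys) =
      (\<Sum>m<?p. \<omega> (hd u) (xs ! m) *\<^sub>C necklace (tl u @ drop (Suc m) xs @ ys @ take m xs)) +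
      (\<Sum>m<?q. \<omega> (hd u) (ys ! m) *\<^sub>C necklace (tl u @ drop (Suc m) ys @ xs @ take m ys))" for u
    unfolding rotation_sum_nth[symmetric, where h = "\<lambda>a v. \<omega> (hd u) a *\<^sub>C necklace (tl u @ v)"] length_append split
    by (simp add: nth_append)
  then show ?thesis
    by (simp add: bracket_necklace glue_def rotation_sum_add)
qed

text \<open>
  The part of \<open>{us, {vs, ws}}\<close> in which \<open>us\<close> is joined at a bead of \<open>vs\<close>, so that \<open>vs\<close> links the two
  others.
\<close>

definition chain :: "'e list \<Rightarrow> 'e list \<Rightarrow> 'e list \<Rightarrow> 'e cyclic_quotient"
  where "chain us vs ws = rotation_sum (\<lambda>v. rotation_sum (\<lambda>w. \<omega> (hd v) (hd w) *\<^sub>C glue us (tl v) (tl w)) ws) vs"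

text \<open>
  When \<open>us\<close> is joined at a bead of \<open>ws\<close>, the middle necklace is \<open>ws\<close>; the sign comes from the
  contraction of \<open>vs\<close> with \<open>ws\<close>, in which the middle necklace now is the second argument.
\<close>

lemma bracket_bracket_necklace:
  "bracket (necklace us) (bracket (necklace vs) (necklace ws)) = chain us vs ws - chain us ws vs"
proof -
  note lin = bracket_linear(1)[of "necklace us"]
  have "bracket (necklace us) (bracket (necklace vs) (necklace ws)) =
    rotation_sum (\<lambda>v. rotation_sum (\<lambda>w. \<omega> (hd v) (hd w) *\<^sub>C bracket (necklace us) (necklace (tl v @ tl w))) ws) vs"
    using lin unfolding clinear_iff bracket_necklace[of vs ws] clinear_rotation_sum[OF lin] by simp
  also have "\<dots> = chain us vs ws +
    rotation_sum (\<lambda>v. rotation_sum (\<lambda>w. \<omega> (hd v) (hd w) *\<^sub>C glue us (tl w) (tl v)) ws) vs"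
    by (simp add: bracket_necklace_append chain_def rotation_sum_add cvec.scale_right_distrib)
  also have "rotation_sum (\<lambda>v. rotation_sum (\<lambda>w. \<omega> (hd v) (hd w) *\<^sub>C glue us (tl w) (tl v)) ws) vs = - chain us ws vs"
  proof -
    have "\<omega> (hd v) (hd w) *\<^sub>C glue us (tl w) (tl v) = - (\<omega> (hd w) (hd v) *\<^sub>C glue us (tl w) (tl v))" for v w
      by (simp add: antisymmetric[of "hd v" "hd w"])
    then show ?thesis
      unfolding chain_def by (simp only: rotation_sum_minus rotation_sum_swap[of _ ws vs])
  qed
  finally show ?thesis by simp
qed

lemma chain_bead_pair_sum:
  "chain us vs ws = rotation_sum (\<lambda>u. rotation_sum (\<lambda>w. bead_pair_sum
    (\<lambda>a P b Q. (\<omega> a (hd w) * \<omega> (hd u) b) *\<^sub>C necklace (tl u @ Q @ tl w @ P)) vs) ws) us"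
proof -
  have "chain us vs ws = rotation_sum (\<lambda>v. rotation_sum (\<lambda>w. rotation_sum (\<lambda>u. \<Sum>m<length (tl v).
    (\<omega> (hd v) (hd w) * \<omega> (hd u) (tl v ! m)) *\<^sub>C necklace (tl u @ drop (Suc m) (tl v) @ tl w @ take m (tl v))) us) ws) vs"
    unfolding chain_def glue_def
    by (simp add: rotation_sum_def cvec.scale_sum_right scaleC_scaleC)
  then show ?thesis
    unfolding bead_pair_sum_def
    by (simp only: rotation_sum_swap[of _ ws vs] rotation_sum_swap[of _ us vs] rotation_sum_swap[of _ us ws])
qed

text \<open>
  Exchanging the two beads of \<open>vs\<close> contracts \<open>us\<close> with the bead that \<open>ws\<close> had before and conversely.
  Restoring the order of the arguments costs two signs, which cancel, and the resulting necklaces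
  differ by a rotation.
\<close>

lemma chain_reverse: "chain us vs ws = chain ws vs us"
proof -
  have "(\<omega> b (hd w) * \<omega> (hd u) a) *\<^sub>C necklace (tl u @ P @ tl w @ Q) =
    (\<omega> a (hd u) * \<omega> (hd w) b) *\<^sub>C necklace (tl w @ Q @ tl u @ P)" for u w a b P Q
    using necklace_append_commute[of "tl u @ P" "tl w @ Q"]
    by (simp add: antisymmetric[of b] antisymmetric[of "hd u"] mult.commute)
  then show ?thesis
    unfolding chain_bead_pair_sum
    by (subst bead_pair_sum_swap, subst rotation_sum_swap) simp
qed

lemma jacobi: "bracket \<alpha> (bracket \<beta> \<gamma>) + bracket \<beta> (bracket \<gamma> \<alpha>) + bracket \<gamma> (bracket \<alpha> \<beta>) = 0"
proof -
  obtain a b c where abc: "\<alpha> = cyclic_class a" "\<beta> = cyclic_class b" "\<gamma> = cyclic_class c"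
    using cyclic_class_surj by metis
  let ?J = "\<lambda>a b c. cyclic_class (B a (B b c)) + cyclic_class (B b (B c a)) + cyclic_class (B c (B a b))"
  have "?J a b c = 0"
  proof (rule trilinear_pure_tensor_eq_0[of ?J])
    fix us vs ws
    have "?J (pure_tensor us) (pure_tensor vs) (pure_tensor ws) =
      (chain us vs ws - chain us ws vs) + (chain vs ws us - chain vs us ws) + (chain ws us vs - chain ws vs us)"
      by (simp flip: bracket_class necklace_def bracket_bracket_necklace)
    also have "\<dots> = 0"
      by (simp add: chain_reverse[of ws vs us] chain_reverse[of vs ws us] chain_reverse[of ws us vs])
    finally show "?J (pure_tensor us) (pure_tensor vs) (pure_tensor ws) = 0" .
  qed (simp_all add: clinear_iff B_simps cyclic_class_simps cvec.scale_right_distrib)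
  then show ?thesis
    by (simp add: abc bracket_class)
qed

lemma lie_bracket_bracket: "lie_bracket bracket"
  unfolding lie_bracket_def cbilinear_def using bracket_linear bracket_self jacobi by blast

end

theorem proposition1p6:
  fixes \<omega> :: "'e::complex_vector \<Rightarrow> 'e \<Rightarrow> complex"
    and x y :: 'e
    and B :: "'e tensor_algebra \<Rightarrow> 'e tensor_algebra \<Rightarrow> 'e tensor_algebra"
  assumes "symplectic_form \<omega>"
    and "x \<noteq> y" and "cvec.independent {x, y}" and "cvec.span {x, y} = UNIV"
    and "\<omega> x y = 1"
    and "cbilinear B"
    and "\<And>us vs. B (pure_tensor us) (pure_tensor vs) =
      (\<Sum>i<length us. \<Sum>j<length vs. \<omega> (us ! i) (vs ! j) *\<^sub>C
        pure_tensor (drop (Suc i) us @ take i us @ drop (Suc j) vs @ take j vs))"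
  shows "\<exists>!br :: 'e cyclic_quotient \<Rightarrow> 'e cyclic_quotient \<Rightarrow> 'e cyclic_quotient.
    (\<forall>a b. br (cyclic_class a) (cyclic_class b) = cyclic_class (B a b)) \<and> lie_bracket br"
proof -
  interpret necklace_pairing \<omega> B
    using assms(1,6,7) by unfold_locales (auto simp: symplectic_form_def)
  show ?thesis
  proof (rule ex1I[of _ bracket])
    show "(\<forall>a b. bracket (cyclic_class a) (cyclic_class b) = cyclic_class (B a b)) \<and> lie_bracket bracket"
      using bracket_class lie_bracket_bracket by blast
  next
    fix br :: "'e cyclic_quotient \<Rightarrow> 'e cyclic_quotient \<Rightarrow> 'e cyclic_quotient"
    assume br: "(\<forall>a b. br (cyclic_class a) (cyclic_class b) = cyclic_class (B a b)) \<and> lie_bracket br"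
    show "br = bracket"
    proof (intro ext)
      fix \<alpha> \<beta>
      show "br \<alpha> \<beta> = bracket \<alpha> \<beta>"
        using br bracket_class cyclic_class_surj[of \<alpha>] cyclic_class_surj[of \<beta>] by auto
    qed
  qed
qed

end
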